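(* Let $\mathcal{B}=\sum_{j=1}^{M}B_j$ be a Bell operator written as a sum of $M$ observables $B_j$ with measurement outcomes in $\{-1,+1\}$, and let $\langle\mathcal{B}\rangle=\sum_{j=1}^{M}\langle B_j\rangle$. Let $J_1,\dots,J_L$ be independent random variables, each uniformly distributed on $\{1,\dots,M\}$. Each of the $L$ randomly chosen terms is measured $K$ times; let $b_{j}^{(k)}\in\{-1,+1\}$ denote the measurement outcome of the term $B_j$ in the $k$th repetition. Define the estimator $$\langle\hat{\mathcal{B}}\rangle=\frac{M}{KL}\sum_{l=1}^{L}\sum_{k=1}^{K}b_{J_l}^{(k)} .$$ Then: (1) The estimator is unbiased: $\mathbb{E}[\langle\hat{\mathcal{B}}\rangle]=\langle\mathcal{B}\rangle$. (2) If a violation $\theta>C$ of the Bell inequality $\langle\mathcal{B}\rangle\le C$ is observed and $t=\theta-C$, then the $p$ value satisfies $$p\le\mathbb{P}\big(\langle\hat{\mathcal{B}}\rangle-\langle\mathcal{B}\rangle\ge t\big)\le\exp\left(-\frac{t^{2}}{2M^{2}}KL\right).$$ (3) For a confidence level $\gamma=1-p$ this yields the lower bound on $K$ $$K\ge\frac{1}{L}\left\lceil-\frac{2M^{2}}{t^{2}}\ln(1-\gamma)\right\rceil .$$ Since $L\ge\left\lceil-\frac{2M^{2}}{t^{2}}\ln(1-\gamma)\right\rceil$ (the lower bound on the number $L$ of sampled terms obtained in the limit where the expectation values of the sampled terms are known exactly), this becomes $K\ge 1$; as a result, it is sufficient to measure each sampled term only once.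
   Context: A Bell inequality has the form $\langle\mathcal{B}\rangle\le C$, where $C$ is the classical bound, satisfied by every local hidden variable (LHV) model. The null hypothesis $H_0$ is that the measurement outcomes can be described by an LHV model, so that $\langle\mathcal{B}\rangle\le C$. The $p$ value for a value $\theta$ is $p=\mathbb{P}(\langle\hat{\mathcal{B}}\rangle>\theta\mid H_0)$, the probability under $H_0$ that the estimator exceeds $\theta$. An observed result is said to have confidence level $\gamma=1-p$. Both the indices $J_l$ and the measurement outcomes are random; conditioned on $J_l=j$, the outcome $b_{J_l}^{(k)}$ has expectation $\langle B_j\rangle$. The outcomes are obtained from different experimental runs.
   Formalization: Parts (2) and (3) additionally assume that all KL outcomes b_{J_l}^{(k)} are jointly independent, also over k for the same J_l; with independence only given the indices the bound fails (M=2, L=1, B_1=1, B_2=-1, C=0, t=2, K≥2). *)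

theory Defs
  imports "HOL-Probability.Probability"
begin

section \<open>Bell operators and local hidden variable models\<close>

text \<open>
  Parties are indexed by a finite type \<open>'p\<close>; \<open>'x\<close> is the type of local measurement settings and
  \<open>'a\<close> the type of local outcomes. A behaviour assigns to each joint setting the joint law of the
  local outcomes; a quantum state with local measurements gives one by the Born rule.
\<close>

type_synonym ('p, 'x, 'a) behaviour = "('p \<Rightarrow> 'x) \<Rightarrow> ('p \<Rightarrow> 'a) pmf"

text \<open>
  An observable is measured by choosing a local setting for every party and then computing a number
  from the local outcomes (for instance a signed product of local \<open>\<plusminus>1\<close> outcomes).
\<close>

record ('p, 'x, 'a) observable =
  setting :: "'p \<Rightarrow> 'x"
  outcome_value :: "('p \<Rightarrow> 'a) \<Rightarrow> real"

definition obs_expectation :: "('p, 'x, 'a) behaviour \<Rightarrow> ('p, 'x, 'a) observable \<Rightarrow> real" where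
  "obs_expectation q A = measure_pmf.expectation (q (setting A)) (outcome_value A)"

definition bell_value ::
    "nat \<Rightarrow> (nat \<Rightarrow> ('p, 'x, 'a) observable) \<Rightarrow> ('p, 'x, 'a) behaviour \<Rightarrow> real" where
  "bell_value M B q = (\<Sum>j=1..M. obs_expectation q (B j))"

text \<open>
  The hidden variable \<open>h\<close> has law \<open>H\<close>; given \<open>h\<close>, the parties' outcomes are independent and the
  outcome of party \<open>i\<close> depends only on the setting of party \<open>i\<close>.
\<close>

definition lhv :: "'h itself \<Rightarrow> ('p::finite, 'x, 'a) behaviour \<Rightarrow> bool" where
  "lhv TH q \<longleftrightarrow>
    (\<exists>(H :: 'h measure) (resp :: 'p \<Rightarrow> 'x \<Rightarrow> 'h \<Rightarrow> 'a pmf).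
       prob_space H \<and>
       (\<forall>i x a. (\<lambda>h. pmf (resp i x h) a) \<in> borel_measurable H) \<and>
       (\<forall>x a. pmf (q x) a = (\<integral>h. (\<Prod>i\<in>UNIV. pmf (resp i (x i) h) (a i)) \<partial>H)))"

definition bell_inequality ::
    "'h itself \<Rightarrow> nat \<Rightarrow> (nat \<Rightarrow> ('p::finite, 'x, 'a) observable) \<Rightarrow> real \<Rightarrow> bool" where
  "bell_inequality TH M B C \<longleftrightarrow> (\<forall>q. lhv TH q \<longrightarrow> bell_value M B q \<le> C)"


section \<open>The estimator\<close>

text \<open>
  \<open>b l j k\<close> is the outcome of the \<open>k\<close>-th repetition of the measurement of \<open>B\<^sub>j\<close> made for the \<open>l\<close>-th
  sampled term. The index \<open>l\<close> is needed because a term that is sampled twice is measured in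
  different experimental runs.
\<close>

definition sampled_outcome ::
    "(nat \<Rightarrow> 'w \<Rightarrow> nat) \<Rightarrow> (nat \<Rightarrow> nat \<Rightarrow> nat \<Rightarrow> 'w \<Rightarrow> real) \<Rightarrow> nat \<Rightarrow> nat \<Rightarrow> 'w \<Rightarrow> real" where
  "sampled_outcome J b l k \<omega> = b l (J l \<omega>) k \<omega>"

definition estimator ::
    "nat \<Rightarrow> nat \<Rightarrow> nat \<Rightarrow> (nat \<Rightarrow> 'w \<Rightarrow> nat) \<Rightarrow> (nat \<Rightarrow> nat \<Rightarrow> nat \<Rightarrow> 'w \<Rightarrow> real) \<Rightarrow> 'w \<Rightarrow> real" where
  "estimator M K L J b \<omega> =
    real M / (real K * real L) * (\<Sum>l=1..L. \<Sum>k=1..K. sampled_outcome J b l k \<omega>)"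

text \<open>
  Different runs give mutually independent outcomes. This is independence of the
  \<open>K * L\<close> recorded outcomes under the joint law of indices and outcomes, as Hoeffding's inequality
  requires. Independence over \<open>k\<close> only conditionally on the indices would not suffice: with
  \<open>L = 1\<close> and deterministic \<open>B\<^sub>j\<close>, the law of the estimator does not depend on \<open>K\<close>.
\<close>

definition independent_runs ::
    "'w measure \<Rightarrow> nat \<Rightarrow> nat \<Rightarrow> (nat \<Rightarrow> 'w \<Rightarrow> nat) \<Rightarrow> (nat \<Rightarrow> nat \<Rightarrow> nat \<Rightarrow> 'w \<Rightarrow> real) \<Rightarrow> bool" where
  "independent_runs P K L J b \<longleftrightarrow>
    prob_space.indep_vars P (\<lambda>_. borel) (\<lambda>(l, k). sampled_outcome J b l k) ({1..L} \<times> {1..K})"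

text \<open>
  This is the \<open>p\<close> value when \<open>P\<close> is the law of the experiment under the null hypothesis.
\<close>

definition p_value :: "'w measure \<Rightarrow> ('w \<Rightarrow> real) \<Rightarrow> real \<Rightarrow> real" where
  "p_value P T \<theta> = \<P>(\<omega> in P. T \<omega> > \<theta>)"

definition confidence_level :: "'w measure \<Rightarrow> ('w \<Rightarrow> real) \<Rightarrow> real \<Rightarrow> real" where
  "confidence_level P T \<theta> = 1 - p_value P T \<theta>"

definition sample_bound :: "nat \<Rightarrow> real \<Rightarrow> real \<Rightarrow> int" where
  "sample_bound M t \<gamma> = \<lceil>- (2 * (real M)\<^sup>2 / t\<^sup>2) * ln (1 - \<gamma>)\<rceil>"

end

theory Submission
  imports Defs
begin

text \<open>
  Since \<open>J\<^sub>l\<close> is uniform, averaging the conditional expectations of an outcome over the index gives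
  \<open>\<langle>\<B>\<rangle> / M\<close>, so the prefactor \<open>M / (K L)\<close> makes the estimator unbiased. The tail bound is
  Hoeffding's inequality for the \<open>K L\<close> recorded outcomes, each in \<open>[-1, 1]\<close>. It involves \<open>K\<close> and
  \<open>L\<close> only through the integer \<open>K L\<close>, which is why the bound on \<open>K\<close> may be rounded up before the
  division by \<open>L\<close>.
\<close>

text \<open>Conditioning on \<open>A\<close> is integration against the density
  \<open>indicator A / prob A\<close>. This links the conditional expectations, which are integrals
  over \<open>uniform_measure\<close>, to integrals over the original space.\<close>

lemma (in prob_space) expectation_uniform_measure:
  fixes f :: "'a \<Rightarrow> real"
  assumes A: "A \<in> events" and pos: "prob A \<noteq> 0" and f: "f \<in> borel_measurable M"
  shows "(\<integral>x. f x \<partial>uniform_measure M A) = expectation (\<lambda>x. indicator A x * f x) / prob A"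
proof -
  \<comment> \<open>\<open>uniform_measure\<close> divides in \<open>ennreal\<close>, while
    \<open>integral_density\<close> wants a real density. The two quotients agree because
    \<open>prob A\<close> is nonzero.\<close>
  have "indicator A x / emeasure M A = ennreal (indicator A x / prob A)" for x
    using pos
    by (simp add: emeasure_eq_measure ennreal_indicator divide_ennreal measure_nonneg
        order_less_le flip: ennreal_indicator)
  then have "(\<integral>x. f x \<partial>uniform_measure M A)
      = (\<integral>x. f x \<partial>density M (\<lambda>x. ennreal (indicator A x / prob A)))"
    by (simp add: uniform_measure_def)
  also have "\<dots> = expectation (\<lambda>x. (indicator A x / prob A) *\<^sub>R f x)"
    using A f by (intro integral_density) auto
  also have "\<dots> = expectation (\<lambda>x. indicator A x * f x) / prob A"
    by simp
  finally show ?thesis .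
qed

text \<open>Law of total expectation: the events \<open>J = j\<close> partition the space, so
  \<open>f\<close> is a finite sum of its restrictions to them, and each restriction is integrated
  by conditioning on its event.\<close>

lemma (in prob_space) total_expectation:
  fixes f :: "'a \<Rightarrow> real" and I :: "'i set"
  assumes I: "finite I" and J: "J \<in> measurable M (count_space I)" and f: "integrable M f"
  shows "expectation f = (\<Sum>j\<in>I. prob {x \<in> space M. J x = j} *
           (\<integral>x. f x \<partial>uniform_measure M {x \<in> space M. J x = j}))"
proof -
  let ?A = "\<lambda>j. {x \<in> space M. J x = j}"
  have A: "?A j \<in> events" if "j \<in> I" for j
  proof -
    have "?A j = J -` {j} \<inter> space M" by auto
    then show ?thesis using measurable_sets[OF J, of "{j}"] that by simp
  qed
  have part: "f x = (\<Sum>j\<in>I. indicator (?A j) x * f x)" if "x \<in> space M" for x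
  proof -
    have "J x \<in> I" using measurable_space[OF J that] by simp
    then have "(\<Sum>j\<in>I. indicator (?A j) x * f x) = (\<Sum>j\<in>I. if j = J x then f x else 0)"
      using that by (intro sum.cong) (auto simp: indicator_def)
    also have "\<dots> = f x" using I \<open>J x \<in> I\<close> by simp
    finally show ?thesis by simp
  qed
  have "expectation f = expectation (\<lambda>x. \<Sum>j\<in>I. indicator (?A j) x * f x)"
    by (intro Bochner_Integration.integral_cong refl part)
  also have "\<dots> = (\<Sum>j\<in>I. expectation (\<lambda>x. indicator (?A j) x * f x))"
    using integrable_mult_indicator[OF A f] by (intro Bochner_Integration.integral_sum) simp
  also have "\<dots> = (\<Sum>j\<in>I. prob (?A j) * (\<integral>x. f x \<partial>uniform_measure M (?A j)))"
  proof (intro sum.cong refl)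
    fix j assume j: "j \<in> I"
    show "expectation (\<lambda>x. indicator (?A j) x * f x)
        = prob (?A j) * (\<integral>x. f x \<partial>uniform_measure M (?A j))"
    proof (cases "prob (?A j) = 0")
      \<comment> \<open>Conditioning on a null event has no meaning, but the factor
        \<open>prob\<close> removes whatever value the integral takes there, and the restriction of
        \<open>f\<close> vanishes almost everywhere.\<close>
      case True
      then have "AE x in M. x \<notin> ?A j"
        using A[OF j] by (simp add: prob_eq_0)
      then have "AE x in M. indicator (?A j) x * f x = 0"
        by eventually_elim (simp add: indicator_def)
      then have "expectation (\<lambda>x. indicator (?A j) x * f x) = 0"
        by (rule integral_eq_zero_AE)
      with True show ?thesis by simp
    next
      case False
      then show ?thesis
        using expectation_uniform_measure[OF A[OF j] False borel_measurable_integrable[OF f]] by simp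
    qed
  qed
  finally show ?thesis .
qed

text \<open>The random index takes countably many values, and on each event \<open>J l = j\<close>
  the function coincides with the measurable \<open>b l j k\<close>.\<close>

lemma measurable_sampled_outcome:
  assumes "J l \<in> measurable P (count_space {1..M})"
    and "\<And>j. j \<in> {1..M} \<Longrightarrow> b l j k \<in> borel_measurable P"
  shows "sampled_outcome J b l k \<in> borel_measurable P"
  unfolding sampled_outcome_def
  by (rule measurable_compose_countable'[where I="{1..M}" and g="J l" and f="\<lambda>j \<omega>. b l j k \<omega>"])
    (use assms in auto)

text \<open>Since 0 < \<gamma> makes the logarithm negative, the number under the ceiling is
  strictly positive. This is what rules out zero repetitions.\<close>

lemma sample_bound_pos:
  assumes "M \<ge> 1" "t > 0" "0 < \<gamma>" "\<gamma> < 1"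
  shows "sample_bound M t \<gamma> \<ge> 1"
proof -
  have "ln (1 - \<gamma>) < 0" using assms by simp
  moreover have "2 * (real M)\<^sup>2 / t\<^sup>2 > 0" using assms by simp
  ultimately have "- (2 * (real M)\<^sup>2 / t\<^sup>2) * ln (1 - \<gamma>) > 0"
    by (metis mult_neg_neg neg_less_0_iff_less)
  then show ?thesis by (simp add: sample_bound_def)
qed

lemma exp_bound_iff_sample_bound:
  assumes M: "M \<ge> 1" and L: "L \<ge> 1" and t: "t > 0" and g: "\<gamma> < 1"
  shows "exp (- (t\<^sup>2 / (2 * (real M)\<^sup>2)) * real K * real L) \<le> 1 - \<gamma> \<longleftrightarrow>
    real K \<ge> 1 / real L * real_of_int (sample_bound M t \<gamma>)"
proof -
  \<comment> \<open>The decay rate of the exponential bound per recorded outcome; its inverse is the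
    factor in \<open>sample_bound\<close>.\<close>
  define c where "c = t\<^sup>2 / (2 * (real M)\<^sup>2)"
  have c: "c > 0" using M t by (simp add: c_def)
  have "exp (- c * real K * real L) \<le> 1 - \<gamma> \<longleftrightarrow> - c * real K * real L \<le> ln (1 - \<gamma>)"
    using g by (simp add: ln_ge_iff)
  also have "\<dots> \<longleftrightarrow> - (1 / c) * ln (1 - \<gamma>) \<le> real K * real L"
    using c by (auto simp add: field_simps)
  \<comment> \<open>An integer dominates a real number exactly when it dominates its ceiling, so
    viewing \<open>K * L\<close> as an integer lets the bound be rounded up without loss.\<close>
  also have "\<dots> \<longleftrightarrow> - (1 / c) * ln (1 - \<gamma>) \<le> real_of_int (int K * int L)"
    by simp
  also have "\<dots> \<longleftrightarrow> \<lceil>- (1 / c) * ln (1 - \<gamma>)\<rceil> \<le> int K * int L"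
    by (rule ceiling_le_iff[symmetric])
  also have "- (1 / c) * ln (1 - \<gamma>) = - (2 * (real M)\<^sup>2 / t\<^sup>2) * ln (1 - \<gamma>)"
    by (simp add: c_def)
  also have "\<lceil>\<dots>\<rceil> \<le> int K * int L \<longleftrightarrow> real_of_int (sample_bound M t \<gamma>) \<le> real K * real L"
    unfolding sample_bound_def by (metis of_int_le_iff of_int_mult of_int_of_nat_eq)
  also have "\<dots> \<longleftrightarrow> real K \<ge> 1 / real L * real_of_int (sample_bound M t \<gamma>)"
    using L by (simp add: field_simps)
  finally show ?thesis by (simp add: c_def)
qed

text \<open>The quotient \<open>N / L\<close> lies in the half-open interval (0, 1], so the least
  natural number above it is 1.\<close>

lemma repetitions_sufficient_iff:
  assumes "L \<ge> 1" and N: "1 \<le> N" "N \<le> int L"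
  shows "real k \<ge> 1 / real L * real_of_int N \<longleftrightarrow> k \<ge> 1"
proof -
  have "0 < 1 / real L * real_of_int N" using assms by simp
  moreover have "1 / real L * real_of_int N \<le> 1"
    using assms by (simp add: field_simps)
  ultimately show ?thesis
    by (cases "k = 0") auto
qed

text \<open>Total expectation with all weights equal to \<open>1 / M'\<close> averages the terms of
  the Bell operator. The number of terms is \<open>M'\<close> because \<open>M\<close> names the
  probability space here.\<close>

lemma (in prob_space) expectation_sampled_outcome:
  assumes M: "M' \<ge> 1"
    and J: "J l \<in> measurable M (count_space {1..M'})"
    and unif: "distr M (count_space {1..M'}) (J l) = uniform_count_measure {1..M'}"
    and int: "integrable M (sampled_outcome J b l k)"
    and cond: "\<And>j. j \<in> {1..M'} \<Longrightarrow>
      (\<integral>\<omega>. sampled_outcome J b l k \<omega> \<partial>uniform_measure M {\<omega> \<in> space M. J l \<omega> = j})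
        = obs_expectation q (B j)"
  shows "expectation (sampled_outcome J b l k) = bell_value M' B q / real M'"
proof -
  have "prob {\<omega> \<in> space M. J l \<omega> = j} = 1 / real M'" if j: "j \<in> {1..M'}" for j
  proof -
    have "prob {\<omega> \<in> space M. J l \<omega> = j} = prob (J l -` {j} \<inter> space M)"
      by (intro arg_cong[where f=prob]) auto
    also have "\<dots> = measure (uniform_count_measure {1..M'}) {j}"
      using j J by (subst measure_distr[symmetric, where N="count_space {1..M'}"])
        (auto simp only: unif sets_count_space)
    also have "\<dots> = 1 / real M'"
      using j by (subst measure_uniform_count_measure) auto
    finally show ?thesis .
  qed
  then show ?thesis
    using total_expectation[OF _ J int] cond
    by (simp add: bell_value_def sum_divide_distrib)
qed

theorem mainTheorem2:
  fixes P :: "'w measure"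
    and M K L :: nat
    and B :: "nat \<Rightarrow> ('p::finite, 'x, 'a) observable"
    and C :: real
    and q :: "('p, 'x, 'a) behaviour"
    and J :: "nat \<Rightarrow> 'w \<Rightarrow> nat"
    and b :: "nat \<Rightarrow> nat \<Rightarrow> nat \<Rightarrow> 'w \<Rightarrow> real"
  assumes "prob_space P"
    and "M \<ge> 1" and "K \<ge> 1" and "L \<ge> 1"
    and "\<And>j a. j \<in> {1..M} \<Longrightarrow> outcome_value (B j) a \<in> {-1, 1}"
    and "bell_inequality TYPE('h) M B C"
    and "prob_space.indep_vars P (\<lambda>_. count_space {1..M}) J {1..L}"
    and "\<And>l. l \<in> {1..L} \<Longrightarrow>
           distr P (count_space {1..M}) (J l) = uniform_count_measure {1..M}"
    and "\<And>l j k. l \<in> {1..L} \<Longrightarrow> j \<in> {1..M} \<Longrightarrow> k \<in> {1..K} \<Longrightarrow>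
           b l j k \<in> borel_measurable P"
    and "\<And>l j k \<omega>. l \<in> {1..L} \<Longrightarrow> j \<in> {1..M} \<Longrightarrow> k \<in> {1..K} \<Longrightarrow> \<omega> \<in> space P \<Longrightarrow>
           b l j k \<omega> \<in> {-1, 1}"
    and "\<And>l j k. l \<in> {1..L} \<Longrightarrow> j \<in> {1..M} \<Longrightarrow> k \<in> {1..K} \<Longrightarrow>
           prob_space.expectation (uniform_measure P {\<omega> \<in> space P. J l \<omega> = j})
             (sampled_outcome J b l k) = obs_expectation q (B j)"
  shows "prob_space.expectation P (estimator M K L J b) = bell_value M B q \<and>
    (independent_runs P K L J b \<longrightarrow>
      (\<forall>\<theta> t. \<theta> > C \<and> t = \<theta> - C \<longrightarrow>
        (lhv TYPE('h) q \<longrightarrow>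
           p_value P (estimator M K L J b) \<theta>
             \<le> \<P>(\<omega> in P. estimator M K L J b \<omega> - bell_value M B q \<ge> t)) \<and>
        \<P>(\<omega> in P. estimator M K L J b \<omega> - bell_value M B q \<ge> t)
          \<le> exp (- (t\<^sup>2 / (2 * (real M)\<^sup>2)) * real K * real L) \<and>
        (\<forall>\<gamma>. 0 < \<gamma> \<and> \<gamma> < 1 \<longrightarrow>
          (exp (- (t\<^sup>2 / (2 * (real M)\<^sup>2)) * real K * real L) \<le> 1 - \<gamma> \<longleftrightarrow>
             real K \<ge> 1 / real L * real_of_int (sample_bound M t \<gamma>)) \<and>
          (lhv TYPE('h) q \<and> real K \<ge> 1 / real L * real_of_int (sample_bound M t \<gamma>) \<longrightarrow>
             confidence_level P (estimator M K L J b) \<theta> \<ge> \<gamma>) \<and>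
          (int L \<ge> sample_bound M t \<gamma> \<longrightarrow>
             (\<forall>k::nat. real k \<ge> 1 / real L * real_of_int (sample_bound M t \<gamma>) \<longleftrightarrow> k \<ge> 1) \<and>
             (lhv TYPE('h) q \<and> K = 1 \<longrightarrow>
                confidence_level P (estimator M K L J b) \<theta> \<ge> \<gamma>)))))"
proof -
  interpret P: prob_space P by fact
  note M = \<open>M \<ge> 1\<close> and K = \<open>K \<ge> 1\<close> and L = \<open>L \<ge> 1\<close>
  note J_indep = assms(7) and J_unif = assms(8) and b_meas = assms(9) and b_val = assms(10)
    and b_cond = assms(11)
  let ?X = "sampled_outcome J b" and ?T = "estimator M K L J b" and ?v = "bell_value M B q"
  let ?I = "{1..L} \<times> {1..K}"
  have J: "J l \<in> measurable P (count_space {1..M})" if "l \<in> {1..L}" for l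
    using J_indep that by (simp add: P.indep_vars_def)
  have X_meas: "?X l k \<in> borel_measurable P" if "l \<in> {1..L}" "k \<in> {1..K}" for l k
    by (rule measurable_sampled_outcome[OF J]) (use b_meas that in auto)
  \<comment> \<open>Measurability of \<open>J l\<close> into \<open>count_space {1..M}\<close> keeps
    the index in range at every point, so the values of \<open>b\<close> are known there.\<close>
  have X_val: "?X l k \<omega> \<in> {-1, 1}" if "l \<in> {1..L}" "k \<in> {1..K}" "\<omega> \<in> space P" for l k \<omega>
    using b_val[OF that(1) _ that(2,3), of "J l \<omega>"] measurable_space[OF J[OF that(1)] that(3)]
    by (simp add: sampled_outcome_def)
  have X_int: "integrable P (?X l k)" if "l \<in> {1..L}" "k \<in> {1..K}" for l k
    by (rule P.integrable_const_bound[where B=1])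
      (use X_meas X_val that in \<open>fastforce intro!: AE_I2\<close>)+
  have X_exp: "P.expectation (?X l k) = ?v / real M" if "l \<in> {1..L}" "k \<in> {1..K}" for l k
    by (rule P.expectation_sampled_outcome[OF M J J_unif X_int]) (use b_cond that in auto)
  \<comment> \<open>A single sum over pairs is the form in which \<open>independent_runs\<close> and
    Hoeffding's inequality index the outcomes.\<close>
  have T: "?T = (\<lambda>\<omega>. real M / (real K * real L) * (\<Sum>i\<in>?I. ?X (fst i) (snd i) \<omega>))"
    by (simp add: fun_eq_iff estimator_def sum.cartesian_product case_prod_beta)
  have sum_exp: "(\<Sum>i\<in>?I. P.expectation (?X (fst i) (snd i))) = real K * real L * (?v / real M)"
  proof -
    have "(\<Sum>i\<in>?I. P.expectation (?X (fst i) (snd i))) = (\<Sum>i\<in>?I. ?v / real M)"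
      by (intro sum.cong refl X_exp) auto
    then show ?thesis by (simp add: mult_ac)
  qed
  have T_meas: "?T \<in> borel_measurable P"
    unfolding T using X_meas by (intro borel_measurable_times borel_measurable_sum) auto
  have unbiased: "P.expectation ?T = ?v"
  proof -
    have "P.expectation ?T
        = real M / (real K * real L) * (\<Sum>i\<in>?I. P.expectation (?X (fst i) (snd i)))"
      unfolding T using X_int by (subst integral_mult_right_zero, subst Bochner_Integration.integral_sum) auto
    then show ?thesis
      using M K L by (simp only: sum_exp) simp
  qed
  have tail: "\<P>(\<omega> in P. ?T \<omega> - ?v \<ge> t) \<le> exp (- (t\<^sup>2 / (2 * (real M)\<^sup>2)) * real K * real L)"
    if indep: "independent_runs P K L J b" and t: "t > 0" for t
  proof -
    define n where "n = real K * real L"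
    have n: "n > 0" using K L by (simp add: n_def)
    have m: "real M > 0" using M by simp
    \<comment> \<open>Hoeffding is applied to the unscaled sum of outcomes, each in [-1, 1]; the
      last parameter is the mean of that sum.\<close>
    interpret H: Hoeffding_ineq P ?I "\<lambda>i. ?X (fst i) (snd i)" "\<lambda>_. -1" "\<lambda>_. 1"
        "\<Sum>i\<in>?I. P.expectation (?X (fst i) (snd i))"
    proof unfold_locales
      show "P.indep_vars (\<lambda>_. borel) (\<lambda>i. ?X (fst i) (snd i)) ?I"
        using indep by (simp add: independent_runs_def case_prod_beta')
      show "AE \<omega> in P. ?X (fst i) (snd i) \<omega> \<in> {-1..1}" if "i \<in> ?I" for i
        using that X_val[of "fst i" "snd i"] by (intro AE_I2) fastforce
    qed auto
    \<comment> \<open>Each of the \<open>n\<close> intervals has width 2, hence the denominator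
      \<open>4 * n\<close> in the exponent.\<close>
    have d: "(\<Sum>i\<in>?I. (1 - (-1))\<^sup>2) = 4 * n"
      by (simp add: n_def)
    \<comment> \<open>Multiplying by \<open>n / M\<close> turns a deviation \<open>t\<close> of the
      estimator into a deviation \<open>n * t / M\<close> of the sum.\<close>
    have "?T \<omega> - ?v \<ge> t \<longleftrightarrow>
        (\<Sum>i\<in>?I. ?X (fst i) (snd i) \<omega>) \<ge> n * (?v / real M) + n * t / real M" for \<omega>
      unfolding T n_def[symmetric] using n m by (simp add: field_simps)
    then have "\<P>(\<omega> in P. ?T \<omega> - ?v \<ge> t) \<le> exp (- 2 * (n * t / real M)\<^sup>2 / (4 * n))"
      using H.Hoeffding_ineq_ge[of "n * t / real M", unfolded sum_exp d, folded n_def] n m t by simp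
    also have "- 2 * (n * t / real M)\<^sup>2 / (4 * n) = - (t\<^sup>2 / (2 * (real M)\<^sup>2)) * real K * real L"
      using n m by (simp add: power2_eq_square field_simps n_def)
    finally show ?thesis .
  qed
  have pval: "p_value P ?T \<theta> \<le> \<P>(\<omega> in P. ?T \<omega> - ?v \<ge> \<theta> - C)" if "lhv TYPE('h) q" for \<theta>
  proof -
    \<comment> \<open>Under the null hypothesis the true value is at most \<open>C\<close>, so
      exceeding \<theta> forces a deviation of at least \<theta> - C: the first event is contained
      in the second.\<close>
    have "?v \<le> C" using assms(6) that by (simp add: bell_inequality_def)
    then show ?thesis
      unfolding p_value_def using T_meas by (intro P.finite_measure_mono) auto
  qed
  \<comment> \<open>The \<open>p\<close> value is at most the tail probability, which is at most the
    exponential, and the bound on \<open>K\<close> says precisely that the exponential is at most 1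
    - \<gamma>.\<close>
  have conf: "confidence_level P ?T \<theta> \<ge> \<gamma>"
    if "independent_runs P K L J b" "\<theta> > C" "\<gamma> < 1" "lhv TYPE('h) q"
      "real K \<ge> 1 / real L * real_of_int (sample_bound M (\<theta> - C) \<gamma>)" for \<theta> \<gamma>
    using pval[OF that(4), of \<theta>] tail[OF that(1), of "\<theta> - C"] that
      exp_bound_iff_sample_bound[OF M L, of "\<theta> - C" \<gamma> K]
    by (simp add: confidence_level_def)
  have suff: "real k \<ge> 1 / real L * real_of_int (sample_bound M t \<gamma>) \<longleftrightarrow> k \<ge> 1"
    if "t > 0" "0 < \<gamma>" "\<gamma> < 1" "int L \<ge> sample_bound M t \<gamma>" for k :: nat and t \<gamma>
    using repetitions_sufficient_iff[OF L] sample_bound_pos[OF M that(1-3)] that(4) by blast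
  show ?thesis
  proof (intro conjI impI allI; (elim conjE)?)
    show "P.expectation ?T = ?v" by (fact unbiased)
  next
    fix \<theta> t assume "t = \<theta> - C" "lhv TYPE('h) q"
    then show "p_value P ?T \<theta> \<le> \<P>(\<omega> in P. ?T \<omega> - ?v \<ge> t)" using pval by simp
  next
    fix \<theta> t assume "independent_runs P K L J b" "\<theta> > C" "t = \<theta> - C"
    then show "\<P>(\<omega> in P. ?T \<omega> - ?v \<ge> t) \<le> exp (- (t\<^sup>2 / (2 * (real M)\<^sup>2)) * real K * real L)"
      by (intro tail) auto
  next
    fix \<theta> t \<gamma> :: real assume "\<theta> > C" "t = \<theta> - C" "\<gamma> < 1"
    then show "exp (- (t\<^sup>2 / (2 * (real M)\<^sup>2)) * real K * real L) \<le> 1 - \<gamma> \<longleftrightarrow>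
        real K \<ge> 1 / real L * real_of_int (sample_bound M t \<gamma>)"
      by (intro exp_bound_iff_sample_bound M L) auto
  next
    fix \<theta> t \<gamma> assume "independent_runs P K L J b" "\<theta> > C" "t = \<theta> - C" "\<gamma> < 1"
      "lhv TYPE('h) q" "real K \<ge> 1 / real L * real_of_int (sample_bound M t \<gamma>)"
    then show "confidence_level P ?T \<theta> \<ge> \<gamma>" using conf by simp
  next
    fix \<theta> t \<gamma> and k :: nat
    assume "\<theta> > C" "t = \<theta> - C" "0 < \<gamma>" "\<gamma> < 1" "int L \<ge> sample_bound M t \<gamma>"
    then show "real k \<ge> 1 / real L * real_of_int (sample_bound M t \<gamma>) \<longleftrightarrow> k \<ge> 1"
      by (intro suff) auto
  next
    fix \<theta> t \<gamma> assume "independent_runs P K L J b" "\<theta> > C" "t = \<theta> - C" "0 < \<gamma>" "\<gamma> < 1"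
      "int L \<ge> sample_bound M t \<gamma>" "lhv TYPE('h) q" "K = 1"
    then show "confidence_level P ?T \<theta> \<ge> \<gamma>"
      \<comment> \<open>\<open>suff\<close> at the actual number of repetitions shows that
        \<open>K = 1\<close> already meets the bound required by \<open>conf\<close>.\<close>
      using conf[of \<theta> \<gamma>] suff[of t \<gamma> K] by simp
  qed
qed

end
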